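(* Let $\mathcal{H}$ be a finite-dimensional complex Hilbert space, let $H$ be any self-adjoint operator on $\mathcal{H}$ and $(L_k)_k$ any finite family of linear operators on $\mathcal{H}$. Suppose that the Lindblad equation $$\tfrac{d}{dt}\rho=-i[H,\rho]-\tfrac12\sum_k\left(L_k^\dagger L_k\rho+\rho L_k^\dagger L_k-2L_k\rho L_k^\dagger\right)$$ on the set of density operators on $\mathcal{H}$ has a full-rank equilibrium $\rho_\infty$. For each density operator $\rho$, let $G_\rho$ be the solution of $$\rho_\infty G_\rho+G_\rho\rho_\infty=\rho-\rho_\infty .$$ Then the function $V_{\mathrm{Bures}}(\rho)=\mathrm{Tr}(\rho_\infty G_\rho^2)$ is a (non-strict) Lyapunov function for the Lindblad equation, and along its solutions $$\tfrac{d}{dt}V_{\mathrm{Bures}}(\rho)=-\sum_k\mathrm{Tr}\left([G_\rho,L_k]\,\rho_\infty\,[G_\rho,L_k]^\dagger\right).$$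
   Context: A density operator is a self-adjoint, positive semi-definite operator of trace one on $\mathcal{H}$; full rank means positive definite. $[A,B]=AB-BA$ and ${}^\dagger$ denotes the operator adjoint. Since $\rho_\infty$ is positive definite, $G_\rho$ is uniquely defined and Hermitian. A (non-strict) Lyapunov function here means: $V_{\mathrm{Bures}}(\rho)\ge 0$ for all density operators $\rho$, with equality only at $\rho=\rho_\infty$, and $V_{\mathrm{Bures}}$ is non-increasing along solutions of the equation. *)

theory Defs
  imports "HOL-Analysis.Analysis" "HOL-Library.Complex_Order"
begin

text \<open>
  A finite-dimensional complex Hilbert space of dimension \<open>CARD('n)\<close> is represented, in an
  orthonormal basis, by \<open>complex^'n\<close>, and linear operators on it by matrices acting
  through \<open>(*v)\<close>; operator composition is \<open>(**)\<close> (the operation \<open>(*)\<close> on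
  vectors and matrices is componentwise and is not used).  On \<open>complex\<close> the order is
  that of \<open>Complex_Order\<close>: \<open>z \<le> w\<close> means \<open>Re z \<le> Re w\<close> and
  \<open>Im z = Im w\<close>, so \<open>0 \<le> z\<close> says that \<open>z\<close> is real and nonnegative.
\<close>

type_synonym 'n operator = "complex^'n^'n"

definition cinner :: "complex^'n \<Rightarrow> complex^'n \<Rightarrow> complex" where
  "cinner x y = (\<Sum>i\<in>UNIV. cnj (x $ i) * y $ i)"

definition dagger :: "'n::finite operator \<Rightarrow> 'n operator"  ("_\<^sup>\<dagger>" [1000] 1000) where
  "A\<^sup>\<dagger> = (\<chi> i j. cnj (A $ j $ i))"

lemma cinner_dagger: "cinner (A\<^sup>\<dagger> *v x) y = cinner x (A *v y)"
proof -
  have "cinner (A\<^sup>\<dagger> *v x) y = (\<Sum>i\<in>UNIV. \<Sum>j\<in>UNIV. A $ j $ i * cnj (x $ j) * y $ i)"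
    by (simp add: cinner_def dagger_def matrix_vector_mult_def sum_distrib_right)
  also have "\<dots> = (\<Sum>j\<in>UNIV. \<Sum>i\<in>UNIV. A $ j $ i * cnj (x $ j) * y $ i)"
    by (rule sum.swap)
  also have "\<dots> = cinner x (A *v y)"
    by (simp add: cinner_def matrix_vector_mult_def sum_distrib_left algebra_simps)
  finally show ?thesis .
qed

definition cscale :: "complex \<Rightarrow> 'n operator \<Rightarrow> 'n::finite operator"  (infixr "*\<^sub>c" 75) where
  "c *\<^sub>c A = (\<chi> i j. c * A $ i $ j)"

definition commutator :: "'n operator \<Rightarrow> 'n operator \<Rightarrow> 'n::finite operator" where
  "commutator A B = A ** B - B ** A"

definition self_adjoint :: "'n::finite operator \<Rightarrow> bool" where
  "self_adjoint A \<longleftrightarrow> A\<^sup>\<dagger> = A"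

definition positive_semidefinite :: "'n::finite operator \<Rightarrow> bool" where
  "positive_semidefinite A \<longleftrightarrow> self_adjoint A \<and> (\<forall>x. 0 \<le> cinner x (A *v x))"

definition positive_definite :: "'n::finite operator \<Rightarrow> bool" where
  "positive_definite A \<longleftrightarrow> self_adjoint A \<and> (\<forall>x. x \<noteq> 0 \<longrightarrow> 0 < cinner x (A *v x))"

definition density_operator :: "'n::finite operator \<Rightarrow> bool" where
  "density_operator \<rho> \<longleftrightarrow> positive_semidefinite \<rho> \<and> trace \<rho> = 1"

definition lindblad ::
  "'n operator \<Rightarrow> 'k set \<Rightarrow> ('k \<Rightarrow> 'n operator) \<Rightarrow> 'n operator \<Rightarrow> 'n::finite operator" where
  "lindblad H K L \<rho> =
     (- \<i>) *\<^sub>c commutator H \<rho>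
     - (1/2) *\<^sub>R (\<Sum>k\<in>K. (L k)\<^sup>\<dagger> ** L k ** \<rho> + \<rho> ** (L k)\<^sup>\<dagger> ** L k
                            - 2 *\<^sub>R (L k ** \<rho> ** (L k)\<^sup>\<dagger>))"

text \<open>
  The equation is posed on the set of density operators, so solutions take values there.
  The domain \<open>T\<close> may be any interval, with one-sided derivatives at its end points.
\<close>

definition lindblad_solution ::
  "'n operator \<Rightarrow> 'k set \<Rightarrow> ('k \<Rightarrow> 'n operator) \<Rightarrow> real set \<Rightarrow> (real \<Rightarrow> 'n::finite operator) \<Rightarrow> bool"
where
  "lindblad_solution H K L T \<rho> \<longleftrightarrow> is_interval T \<and>
     (\<forall>t\<in>T. density_operator (\<rho> t) \<and>
            (\<rho> has_vector_derivative lindblad H K L (\<rho> t)) (at t within T))"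

definition lindblad_equilibrium ::
  "'n operator \<Rightarrow> 'k set \<Rightarrow> ('k \<Rightarrow> 'n operator) \<Rightarrow> 'n::finite operator \<Rightarrow> bool" where
  "lindblad_equilibrium H K L \<rho> \<longleftrightarrow> density_operator \<rho> \<and> lindblad H K L \<rho> = 0"

definition G_op :: "'n operator \<Rightarrow> 'n operator \<Rightarrow> 'n::finite operator" where
  "G_op \<rho>inf \<rho> = (THE G. \<rho>inf ** G + G ** \<rho>inf = \<rho> - \<rho>inf)"

definition V_Bures :: "'n operator \<Rightarrow> 'n::finite operator \<Rightarrow> complex" where
  "V_Bures \<rho>inf \<rho> = trace (\<rho>inf ** (G_op \<rho>inf \<rho> ** G_op \<rho>inf \<rho>))"

text \<open>
  Candidate Lyapunov functions are complex valued because traces are; that \<open>V\<close> is real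
  on density operators is part of the condition \<open>0 \<le> V \<rho>\<close>.
\<close>

definition lyapunov_function ::
  "'n operator \<Rightarrow> 'k set \<Rightarrow> ('k \<Rightarrow> 'n operator) \<Rightarrow> 'n operator \<Rightarrow> ('n::finite operator \<Rightarrow> complex) \<Rightarrow> bool"
where
  "lyapunov_function H K L \<rho>inf V \<longleftrightarrow>
     (\<forall>\<rho>. density_operator \<rho> \<longrightarrow> 0 \<le> V \<rho> \<and> (V \<rho> = 0 \<longleftrightarrow> \<rho> = \<rho>inf)) \<and>
     (\<forall>T \<rho>. lindblad_solution H K L T \<rho> \<longrightarrow>
        (\<forall>s\<in>T. \<forall>t\<in>T. s \<le> t \<longrightarrow> V (\<rho> t) \<le> V (\<rho> s)))"

end

(* Write S X = R X + X R with R the equilibrium, so that G = S^{-1}(rho - R). Positivity of R makes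
   S injective, hence bijective, and V = Tr (G R G) is a sum of values of the quadratic form of R.
   Since S is symmetric for the trace pairing, dV/dt = Tr (G (Lindblad rho)) = Tr (G (Lindblad (S G))).
   Moving the Lindblad generator to G by duality, the carre du champ identity
   Lind*(G^2) - G Lind*(G) - Lind*(G) G = sum [G,L]^dagger [G,L] and Tr (R Lind*(G^2)) = 0
   give the dissipation formula. *)

theory Submission
  imports Defs
begin

section \<open>Matrix algebra and traces\<close>

lemma matrix_sub_ldistrib: "(A :: 'a::ring_1^'n^'m) ** (B - C) = A ** B - A ** C"
  by (simp add: matrix_matrix_mult_def vec_eq_iff sum_subtractf algebra_simps)

lemma matrix_sub_rdistrib: "((A :: 'a::ring_1^'n^'m) - B) ** C = A ** C - B ** C"
  by (simp add: matrix_matrix_mult_def vec_eq_iff sum_subtractf algebra_simps)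

lemma matrix_add_rdistrib: "((A :: 'a::semiring_1^'n^'m) + B) ** C = A ** C + B ** C"
  by (simp add: matrix_matrix_mult_def vec_eq_iff sum.distrib algebra_simps)

lemma bounded_bilinear_matrix_mult:
  "bounded_bilinear ((**) :: complex^'n^'m \<Rightarrow> complex^'p^'n \<Rightarrow> complex^'p^'m)"
  unfolding bilinear_conv_bounded_bilinear [symmetric] bilinear_def
  by (auto intro!: linearI
      simp: matrix_matrix_mult_def vec_eq_iff sum.distrib scaleR_sum_right algebra_simps)

lemma bounded_linear_trace: "bounded_linear (trace :: 'n::finite operator \<Rightarrow> complex)"
  unfolding linear_conv_bounded_linear [symmetric]
  by (rule linearI) (simp_all add: trace_def sum.distrib scaleR_sum_right)

lemmas matrix_expand = matrix_add_ldistrib matrix_add_rdistrib matrix_sub_ldistrib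
  matrix_sub_rdistrib trace_add trace_sub matrix_mul_assoc

lemma trace_cscale: "trace (c *\<^sub>c A) = c * trace A"
  by (simp add: trace_def cscale_def sum_distrib_left)

lemma matrix_mult_cscale: "A ** (c *\<^sub>c B) = c *\<^sub>c (A ** B)"
  by (simp add: matrix_matrix_mult_def cscale_def vec_eq_iff sum_distrib_left algebra_simps)

lemma trace_matrix_mult_scaleR:
  "trace ((A :: 'n::finite operator) ** (r *\<^sub>R B)) = of_real r * trace (A ** B)"
  by (simp add: bounded_bilinear.scaleR_right [OF bounded_bilinear_matrix_mult]
      linear_simps(5) [OF bounded_linear_trace] scaleR_conv_of_real [where 'a = complex])

lemma trace_matrix_mult_sum:
  "trace ((A :: 'n::finite operator) ** (\<Sum>k\<in>K. f k)) = (\<Sum>k\<in>K. trace (A ** f k))"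
  by (simp add: bounded_bilinear.sum_right [OF bounded_bilinear_matrix_mult]
      Real_Vector_Spaces.linear_sum [OF bounded_linear.linear [OF bounded_linear_trace]])

lemma dagger_dagger [simp]: "A\<^sup>\<dagger>\<^sup>\<dagger> = A"
  by (simp add: dagger_def vec_eq_iff)

lemma dagger_mult: "(A ** B)\<^sup>\<dagger> = B\<^sup>\<dagger> ** A\<^sup>\<dagger>"
  by (simp add: dagger_def matrix_matrix_mult_def vec_eq_iff mult.commute)

lemma dagger_add: "(A + B)\<^sup>\<dagger> = A\<^sup>\<dagger> + B\<^sup>\<dagger>"
  by (simp add: dagger_def vec_eq_iff)

lemma dagger_diff: "(A - B)\<^sup>\<dagger> = A\<^sup>\<dagger> - B\<^sup>\<dagger>"
  by (simp add: dagger_def vec_eq_iff)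

text \<open>The \<open>i\<close>-th diagonal entry of \<open>X\<^sup>\<dagger> ** A ** X\<close> is
  the quadratic form of \<open>A\<close> at the \<open>i\<close>-th column of \<open>X\<close>.
  Positivity of traces thus reduces to positivity of the form.\<close>

lemma trace_sandwich:
  "trace (X\<^sup>\<dagger> ** A ** X) = (\<Sum>i\<in>UNIV. cinner (column i X) (A *v column i X))"
  unfolding matrix_mul_assoc [symmetric]
  by (simp add: trace_def cinner_def dagger_def column_def
      matrix_matrix_mult_def matrix_vector_mult_def)

section \<open>Positivity\<close>

lemma trace_sandwich_nonneg:
  assumes "positive_semidefinite A"
  shows "0 \<le> trace (X\<^sup>\<dagger> ** A ** X)"
  using assms unfolding trace_sandwich positive_semidefinite_def by (simp add: sum_nonneg)

lemma positive_definite_imp_semidefinite: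
  assumes "positive_definite A"
  shows "positive_semidefinite A"
proof -
  have "0 \<le> cinner x (A *v x)" for x
    using assms by (cases "x = 0") (auto simp: positive_definite_def cinner_def less_imp_le)
  then show ?thesis
    using assms by (simp add: positive_definite_def positive_semidefinite_def)
qed

text \<open>All summands in \<open>trace_sandwich\<close> are nonnegative, so a zero trace makes
  each of them vanish, and definiteness then kills every column of \<open>X\<close>.\<close>

lemma trace_sandwich_eq_0_iff:
  assumes "positive_definite A"
  shows "trace (X\<^sup>\<dagger> ** A ** X) = 0 \<longleftrightarrow> X = 0"
proof
  assume "trace (X\<^sup>\<dagger> ** A ** X) = 0"
  moreover have "0 \<le> cinner x (A *v x)" for x
    using positive_definite_imp_semidefinite [OF assms] by (simp add: positive_semidefinite_def)
  ultimately have "cinner (column i X) (A *v column i X) = 0" for i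
    unfolding trace_sandwich by (subst (asm) sum_nonneg_eq_0_iff) auto
  then have "column i X = 0" for i
    using assms unfolding positive_definite_def by (metis less_irrefl)
  then show "X = 0"
    by (simp add: column_def vec_eq_iff)
qed (simp add: trace_def)

section \<open>The Lyapunov equation\<close>

lemma linear_anticommutator: "linear (\<lambda>X :: 'n::finite operator. R ** X + X ** R)"
  by (rule linearI)
    (simp_all add: matrix_expand algebra_simps
      bounded_bilinear.scaleR_right [OF bounded_bilinear_matrix_mult]
      bounded_bilinear.scaleR_left [OF bounded_bilinear_matrix_mult])

text \<open>Pairing a kernel element \<open>X\<close> with its own adjoint under the trace gives a
  vanishing sum of two nonnegative sandwich traces, so both are zero.\<close>

lemma inj_anticommutator:
  assumes "positive_definite R"
  shows "inj (\<lambda>X. R ** X + X ** R)"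
  unfolding linear_injective_0 [OF linear_anticommutator]
proof (intro allI impI)
  fix X assume "R ** X + X ** R = 0"
  then have "trace (X\<^sup>\<dagger> ** (R ** X + X ** R)) = 0"
    by (simp add: trace_def)
  \<comment> \<open>Cyclicity turns the second summand into the sandwich trace of
    \<open>X\<^sup>\<dagger>\<close>.\<close>
  moreover have "trace (X\<^sup>\<dagger> ** X ** R) = trace (X\<^sup>\<dagger>\<^sup>\<dagger> ** R ** X\<^sup>\<dagger>)"
    using trace_mul_sym [of "X\<^sup>\<dagger>" "X ** R"] by (simp only: dagger_dagger matrix_mul_assoc)
  ultimately have "trace (X\<^sup>\<dagger> ** R ** X) + trace (X\<^sup>\<dagger>\<^sup>\<dagger> ** R ** X\<^sup>\<dagger>) = 0"
    by (simp add: matrix_expand)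
  then have "trace (X\<^sup>\<dagger> ** R ** X) = 0"
    using trace_sandwich_nonneg [OF positive_definite_imp_semidefinite [OF assms]]
    by (metis add_nonneg_eq_0_iff)
  then show "X = 0"
    by (simp add: trace_sandwich_eq_0_iff [OF assms])
qed

lemma G_op_eqI:
  assumes "positive_definite R" "R ** X + X ** R = \<rho> - R"
  shows "G_op R \<rho> = X"
  unfolding G_op_def
proof (rule the_equality)
  fix Y assume "R ** Y + Y ** R = \<rho> - R"
  with assms(2) show "Y = X"
    by - (rule injD [OF inj_anticommutator [OF assms(1)]], simp)
qed (rule assms(2))

text \<open>In finite dimension the injective anticommutator map is also surjective, so the definite
  description in \<open>G_op\<close> denotes an actual solution.\<close>

lemma G_op_eq:
  assumes "positive_definite R"
  shows "R ** G_op R \<rho> + G_op R \<rho> ** R = \<rho> - R"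
proof -
  obtain X where X: "\<rho> - R = R ** X + X ** R"
    by (rule surjE [OF linear_injective_imp_surjective
          [OF linear_anticommutator inj_anticommutator [OF assms] refl]])
  then show ?thesis
    using G_op_eqI [OF assms X [symmetric]] by simp
qed

lemma G_op_eq_0_iff:
  assumes "positive_definite R"
  shows "G_op R \<rho> = 0 \<longleftrightarrow> \<rho> = R"
  using G_op_eq [OF assms, of \<rho>] G_op_eqI [OF assms, of 0 \<rho>]
  by auto

text \<open>Taking adjoints swaps the two products and fixes the right-hand side, so the adjoint
  solves the same equation and uniqueness applies.\<close>

lemma self_adjoint_G_op:
  assumes "positive_definite R" "self_adjoint \<rho>"
  shows "(G_op R \<rho>)\<^sup>\<dagger> = G_op R \<rho>"
proof -
  let ?G = "G_op R \<rho>"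
  have "(R ** ?G + ?G ** R)\<^sup>\<dagger> = (\<rho> - R)\<^sup>\<dagger>"
    by (simp add: G_op_eq assms)
  then have "R ** ?G\<^sup>\<dagger> + ?G\<^sup>\<dagger> ** R = \<rho> - R"
    using assms
    by (simp add: dagger_add dagger_diff dagger_mult self_adjoint_def positive_definite_def
        add.commute)
  then show ?thesis
    by (rule G_op_eqI [OF assms(1), symmetric])
qed

text \<open>\<open>G_op R\<close> is affine: it is the inverse anticommutator map applied to
  \<open>\<rho> - R\<close>, and a bounded linear map commutes with differentiation. The derivative
  is exposed through its Lyapunov equation, the form in which it is used.\<close>

lemma G_op_has_vector_derivative:
  assumes "positive_definite R" "(\<rho> has_vector_derivative \<rho>') (at t within T)"
  obtains G' where "((\<lambda>s. G_op R (\<rho> s)) has_vector_derivative G') (at t within T)"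
    and "R ** G' + G' ** R = \<rho>'"
proof -
  let ?S = "\<lambda>X. R ** X + X ** R"
  have bij: "inj ?S" "surj ?S"
    using inj_anticommutator [OF assms(1)]
      linear_injective_imp_surjective [OF linear_anticommutator inj_anticommutator [OF assms(1)] refl]
    by simp_all
  have G: "G_op R = (\<lambda>\<rho>. inv ?S (\<rho> - R))"
    by (rule ext, rule G_op_eqI [OF assms(1)]) (rule surj_f_inv_f [OF bij(2)])
  have lin: "bounded_linear (inv ?S)"
    by (intro inj_linear_imp_inv_bounded_linear bij(1) linear_anticommutator
        linear_linear [THEN iffD2])
  show thesis
  proof (rule that)
    have "((\<lambda>s. \<rho> s - R) has_vector_derivative \<rho>') (at t within T)"
      using has_vector_derivative_diff [OF assms(2) has_vector_derivative_const] by simp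
    then show "((\<lambda>s. G_op R (\<rho> s)) has_vector_derivative inv ?S \<rho>') (at t within T)"
      unfolding G by (rule bounded_linear.has_vector_derivative [OF lin])
    show "R ** inv ?S \<rho>' + inv ?S \<rho>' ** R = \<rho>'"
      by (rule surj_f_inv_f [OF bij(2)])
  qed
qed

text \<open>Cyclicity and self-adjointness of \<open>G_op R \<rho>\<close> give the form from which
  nonnegativity and definiteness can be read off.\<close>

lemma V_Bures_eq_sandwich:
  assumes "positive_definite R" "self_adjoint \<rho>"
  shows "V_Bures R \<rho> = trace ((G_op R \<rho>)\<^sup>\<dagger> ** R ** G_op R \<rho>)"
  unfolding V_Bures_def self_adjoint_G_op [OF assms]
  using trace_mul_sym [of "R ** G_op R \<rho>" "G_op R \<rho>"] by (simp only: matrix_mul_assoc)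

text \<open>After the product rule, symmetry of the anticommutator map for the trace pairing moves
  it from \<open>G\<close> to \<open>G'\<close>, where it yields \<open>\<rho>'\<close>.\<close>

lemma V_Bures_has_vector_derivative:
  assumes "positive_definite R" "(\<rho> has_vector_derivative \<rho>') (at t within T)"
  shows "((\<lambda>s. V_Bures R (\<rho> s)) has_vector_derivative trace (G_op R (\<rho> t) ** \<rho>'))
           (at t within T)"
proof -
  let ?G = "G_op R (\<rho> t)"
  obtain G' where G': "((\<lambda>s. G_op R (\<rho> s)) has_vector_derivative G') (at t within T)"
    and eq: "R ** G' + G' ** R = \<rho>'"
    using G_op_has_vector_derivative [OF assms] .
  have "((\<lambda>s. V_Bures R (\<rho> s)) has_vector_derivative trace (R ** (?G ** G' + G' ** ?G)))
          (at t within T)"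
    unfolding V_Bures_def
    by (intro bounded_linear.has_vector_derivative [OF bounded_linear_trace]
        bounded_linear.has_vector_derivative
          [OF bounded_bilinear.bounded_linear_right [OF bounded_bilinear_matrix_mult]]
        bounded_bilinear.has_vector_derivative [OF bounded_bilinear_matrix_mult] G')
  also have "trace (R ** (?G ** G' + G' ** ?G)) = trace (?G ** \<rho>')"
  proof -
    have "trace (R ** ?G ** G') = trace (?G ** G' ** R)" "trace (R ** G' ** ?G) = trace (?G ** R ** G')"
      using trace_mul_sym [of R "?G ** G'"] trace_mul_sym [of "R ** G'" ?G]
      by (simp_all only: matrix_mul_assoc)
    then show ?thesis
      unfolding eq [symmetric] by (simp add: matrix_expand)
  qed
  finally show ?thesis .
qed

section \<open>Dissipation\<close>

text \<open>The traces of \<open>G ** H ** G ** R\<close> and \<open>G ** R ** G ** H\<close> agree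
  by cyclicity and cancel, so the Hamiltonian part causes no dissipation.\<close>

lemma trace_commutator_duality:
  "trace (G ** commutator H (R ** G + G ** R)) = trace (G ** G ** commutator H R)"
  for G H R :: "'n::finite operator"
proof -
  have "trace (G ** H ** R ** G) = trace (G ** G ** H ** R)"
    "trace (G ** H ** G ** R) = trace (G ** R ** G ** H)"
    using trace_mul_sym [of "G ** H ** R" G] trace_mul_sym [of "G ** H" "G ** R"]
    by (simp_all only: matrix_mul_assoc)
  then show ?thesis
    by (simp add: commutator_def matrix_expand)
qed

text \<open>This is the carre du champ identity under the trace, with \<open>P\<close> in the role
  of the adjoint of \<open>L\<close>; cyclicity alone proves it, so \<open>P\<close> may be
  arbitrary. \<open>D\<close> is -2 times the usual dissipator, whence the sign and the factor
  2.\<close>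

lemma trace_dissipator_duality:
  fixes G R L P :: "'n::finite operator"
  defines "D \<equiv> \<lambda>X. P ** L ** X + X ** P ** L - 2 *\<^sub>R (L ** X ** P)"
  shows "trace (G ** D (R ** G + G ** R)) =
    trace (G ** G ** D R) + 2 * trace ((G ** L - L ** G) ** R ** (P ** G - G ** P))"
proof -
  have "trace (G ** P ** L ** R ** G) = trace (G ** G ** P ** L ** R)"
    "trace (G ** P ** L ** G ** R) = trace (L ** G ** R ** G ** P)"
    "trace (G ** R ** G ** P ** L) = trace (L ** G ** R ** G ** P)"
    "trace (L ** G ** R ** P ** G) = trace (G ** L ** G ** R ** P)"
    "trace (G ** L ** R ** P ** G) = trace (G ** G ** L ** R ** P)"
    using trace_mul_sym [of "G ** P ** L ** R" G] trace_mul_sym [of "G ** P" "L ** G ** R"]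
      trace_mul_sym [of "G ** R ** G ** P" L] trace_mul_sym [of "L ** G ** R ** P" G]
      trace_mul_sym [of "G ** L ** R ** P" G]
    by (simp_all only: matrix_mul_assoc)
  then show ?thesis
    by (simp add: D_def trace_matrix_mult_scaleR matrix_expand algebra_simps)
qed

text \<open>Identifies the factor \<open>P ** G - G ** P\<close> of
  \<open>trace_dissipator_duality\<close>, at \<open>P = A\<^sup>\<dagger>\<close>, as the adjoint
  of the commutator.\<close>

lemma dagger_commutator:
  assumes "G\<^sup>\<dagger> = G"
  shows "(commutator G A)\<^sup>\<dagger> = A\<^sup>\<dagger> ** G - G ** A\<^sup>\<dagger>"
  using assms by (simp add: commutator_def dagger_diff dagger_mult)

lemma trace_G_lindblad:
  fixes R G :: "'n::finite operator"
  assumes "lindblad H K L R = 0" "G\<^sup>\<dagger> = G" "R ** G + G ** R = \<rho> - R"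
  shows "trace (G ** lindblad H K L \<rho>) =
    - (\<Sum>k\<in>K. trace (commutator G (L k) ** R ** (commutator G (L k))\<^sup>\<dagger>))"
proof -
  define D where "D k X = (L k)\<^sup>\<dagger> ** L k ** X + X ** (L k)\<^sup>\<dagger> ** L k - 2 *\<^sub>R (L k ** X ** (L k)\<^sup>\<dagger>)"
    for k X
  \<comment> \<open>The left factor stays general because both \<open>G\<close> and
    \<open>G ** G\<close> are paired with the generator below.\<close>
  have tr: "trace (Y ** lindblad H K L X) =
      - \<i> * trace (Y ** commutator H X) - 1/2 * (\<Sum>k\<in>K. trace (Y ** D k X))" for X Y
    by (simp add: lindblad_def D_def [symmetric] matrix_sub_ldistrib trace_sub matrix_mult_cscale
        trace_cscale trace_matrix_mult_scaleR trace_matrix_mult_sum)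
  have \<rho>: "\<rho> = (R ** G + G ** R) + R"
    using assms(3) by simp
  have "trace (G ** lindblad H K L (X + R)) =
      trace (G ** lindblad H K L X) + trace (G ** lindblad H K L R)" for X
    unfolding tr by (simp add: D_def commutator_def trace_matrix_mult_scaleR matrix_expand
        sum.distrib sum_subtractf sum_distrib_left algebra_simps)
  \<comment> \<open>The equilibrium condition removes the contribution of the summand
    \<open>R\<close> of \<open>\<rho>\<close>.\<close>
  then have "trace (G ** lindblad H K L \<rho>) = trace (G ** lindblad H K L (R ** G + G ** R))"
    by (simp add: \<rho> assms(1) linear_simps(3) [OF bounded_linear_trace])
  \<comment> \<open>The factor 2 from the dissipator duality cancels the 1/2 of the generator; the
    other terms reassemble into the generator at \<open>R\<close>, paired with
    \<open>G ** G\<close>.\<close>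
  also have "\<dots> = trace (G ** G ** lindblad H K L R)
      - (\<Sum>k\<in>K. trace (commutator G (L k) ** R ** (commutator G (L k))\<^sup>\<dagger>))"
    unfolding tr trace_commutator_duality D_def trace_dissipator_duality dagger_commutator [OF assms(2)]
    by (simp add: commutator_def sum.distrib sum_distrib_left algebra_simps)
  also have "trace (G ** G ** lindblad H K L R) = 0"
    by (simp add: assms(1) trace_def)
  finally show ?thesis
    by simp
qed

theorem mainTheorem2:
  fixes H :: "complex^'n^'n"
    and K :: "'k set"
    and L :: "'k \<Rightarrow> complex^'n^'n"
    and \<rho>inf :: "complex^'n^'n"
  assumes "self_adjoint H"
    and "finite K"
    and "lindblad_equilibrium H K L \<rho>inf"
    and "positive_definite \<rho>inf"
  shows "lyapunov_function H K L \<rho>inf (V_Bures \<rho>inf) \<and>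
    (\<forall>T \<rho> t. lindblad_solution H K L T \<rho> \<longrightarrow> t \<in> T \<longrightarrow>
       ((\<lambda>s. V_Bures \<rho>inf (\<rho> s)) has_vector_derivative
          - (\<Sum>k\<in>K. trace (commutator (G_op \<rho>inf (\<rho> t)) (L k) ** \<rho>inf
                        ** (commutator (G_op \<rho>inf (\<rho> t)) (L k))\<^sup>\<dagger>)))
         (at t within T))"
proof -
  let ?C = "\<lambda>\<rho> k. commutator (G_op \<rho>inf \<rho>) (L k)"
  let ?W = "\<lambda>\<rho>. \<Sum>k\<in>K. trace (?C \<rho> k ** \<rho>inf ** (?C \<rho> k)\<^sup>\<dagger>)"
  note psd = positive_definite_imp_semidefinite [OF assms(4)]
  have sa: "self_adjoint \<rho>" if "density_operator \<rho>" for \<rho> :: "complex^'n^'n"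
    using that by (simp add: density_operator_def positive_semidefinite_def)
  have V: "0 \<le> V_Bures \<rho>inf \<rho>" "V_Bures \<rho>inf \<rho> = 0 \<longleftrightarrow> \<rho> = \<rho>inf"
    if "density_operator \<rho>" for \<rho>
    using that by (simp_all add: V_Bures_eq_sandwich assms(4) sa trace_sandwich_nonneg psd
        trace_sandwich_eq_0_iff G_op_eq_0_iff)
  \<comment> \<open>Each summand is the sandwich trace of the adjoint of the commutator, hence the
    instance at \<open>(?C \<rho> _)\<^sup>\<dagger>\<close>.\<close>
  have W: "0 \<le> ?W \<rho>" for \<rho>
    using trace_sandwich_nonneg [OF psd, of "(?C \<rho> _)\<^sup>\<dagger>"] by (simp add: sum_nonneg)
  have deriv: "((\<lambda>s. V_Bures \<rho>inf (\<rho> s)) has_vector_derivative - ?W (\<rho> t)) (at t within T)"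
    if "lindblad_solution H K L T \<rho>" "t \<in> T" for T \<rho> t
  proof -
    have "density_operator (\<rho> t)"
      and \<rho>': "(\<rho> has_vector_derivative lindblad H K L (\<rho> t)) (at t within T)"
      using that by (auto simp: lindblad_solution_def)
    then have "trace (G_op \<rho>inf (\<rho> t) ** lindblad H K L (\<rho> t)) = - ?W (\<rho> t)"
      using assms(3,4)
      by (intro trace_G_lindblad self_adjoint_G_op G_op_eq sa) (simp_all add: lindblad_equilibrium_def)
    then show ?thesis
      using V_Bures_has_vector_derivative [OF assms(4) \<rho>'] by simp
  qed
  have mono: "V_Bures \<rho>inf (\<rho> t) \<le> V_Bures \<rho>inf (\<rho> s)"
    if sol: "lindblad_solution H K L T \<rho>" and st: "s \<in> T" "t \<in> T" "s \<le> t" for T \<rho> s t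
  proof -
    have sub: "{s..t} \<subseteq> T"
      using mem_is_interval_1_I [of T s t] sol st by (auto simp: lindblad_solution_def)
    \<comment> \<open>The mean value theorem is applied to the real part, with the derivative
      restricted from \<open>T\<close> to the closed interval \<open>{s..t}\<close>.\<close>
    have "((\<lambda>r. Re (V_Bures \<rho>inf (\<rho> r))) has_real_derivative - Re (?W (\<rho> r))) (at r within {s..t})"
      if "r \<in> {s..t}" for r
      using bounded_linear.has_vector_derivative [OF bounded_linear_Re
          has_vector_derivative_within_subset [OF deriv [OF sol subsetD [OF sub that]] sub]]
      by (simp add: has_real_derivative_iff_has_vector_derivative)
    then obtain r where
      "Re (V_Bures \<rho>inf (\<rho> t)) - Re (V_Bures \<rho>inf (\<rho> s)) = - Re (?W (\<rho> r)) * (t - s)"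
      using mvt_very_simple [OF st(3), of "\<lambda>r. Re (V_Bures \<rho>inf (\<rho> r))"
          "\<lambda>r. (*) (- Re (?W (\<rho> r)))"]
      by (auto simp: has_field_derivative_def)
    moreover have "0 \<le> Re (?W (\<rho> r)) * (t - s)"
      using W [of "\<rho> r"] st(3) by (simp add: less_eq_complex_def)
    ultimately have "Re (V_Bures \<rho>inf (\<rho> t)) \<le> Re (V_Bures \<rho>inf (\<rho> s))"
      by linarith
    \<comment> \<open>With both imaginary parts zero, comparing real parts is the same as comparing
      in the order on \<open>complex\<close>.\<close>
    moreover have "Im (V_Bures \<rho>inf (\<rho> r)) = 0" if "r \<in> T" for r
      using V(1) [of "\<rho> r"] sol that by (simp add: lindblad_solution_def less_eq_complex_def)
    ultimately show ?thesis
      using st by (simp add: less_eq_complex_def)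
  qed
  show ?thesis
    unfolding lyapunov_function_def by (intro conjI allI impI ballI V mono deriv)
qed

end
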